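(* Let $1\le k\le n-1$ be integers and let $D_{k,n}(t)\in\mathbb{Q}[t]$ be the Ehrhart polynomial of the matroid polytope of the minimal matroid $T_{k,n}$. Then \[D_{k,n}(t) = \sum_{j=0}^{k-1} \binom{k-1}{j}\binom{n-k-1}{j}\binom{t+n-1-j}{n-1}.\]
   Context: For integers $1\le k\le n-1$, $T_{k,n}$ denotes the cycle matroid of the graph obtained from a cycle of length $k+1$ by replacing one of its edges with $n-k$ parallel edges. For a matroid $M$ on $\{1,\dots,n\}$, its matroid polytope is $\mathscr{P}(M)=\operatorname{conv}\{\sum_{i\in B}e_i : B \text{ a basis of } M\}\subseteq\mathbb{R}^n$, and its Ehrhart polynomial is the polynomial $i(t)$ with $i(t)=\#(t\mathscr{P}(M)\cap\mathbb{Z}^n)$ for all integers $t\ge0$. *)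

theory Defs
  imports "HOL-Analysis.Analysis" "HOL-Computational_Algebra.Polynomial"
begin

text \<open>Undirected multigraphs; an edge whose set of ends is a singleton is a loop.\<close>

record ('v, 'e) multigraph =
  verts :: "'v set"
  edges :: "'e set"
  ends :: "'e \<Rightarrow> 'v set"

text \<open>\<open>C\<close> is the edge set of a cycle \<open>v\<^sub>0 e\<^sub>0 v\<^sub>1 e\<^sub>1 \<dots> v\<^sub>0\<close>
  without repeated vertices or edges. Length 1 (a loop) and length 2 (two parallel
  edges) are included.\<close>

definition is_cycle :: "('v, 'e) multigraph \<Rightarrow> 'e set \<Rightarrow> bool" where
  "is_cycle G C \<longleftrightarrow>
    (\<exists>vs es. es \<noteq> [] \<and> length vs = length es \<and> distinct vs \<and> distinct es \<and>
       set vs \<subseteq> verts G \<and> set es \<subseteq> edges G \<and>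
       (\<forall>i < length es. ends G (es ! i) = {vs ! i, vs ! (Suc i mod length es)}) \<and>
       C = set es)"

text \<open>Matroids are given by their ground set and independent sets. The matroid axioms are
  not part of the type.\<close>

record 'e matroid =
  ground :: "'e set"
  indep :: "'e set \<Rightarrow> bool"

definition is_basis :: "'e matroid \<Rightarrow> 'e set \<Rightarrow> bool" where
  "is_basis M B \<longleftrightarrow>
    B \<subseteq> ground M \<and> indep M B \<and>
    (\<forall>X. B \<subseteq> X \<and> X \<subseteq> ground M \<and> indep M X \<longrightarrow> X = B)"

definition cycle_matroid :: "('v, 'e) multigraph \<Rightarrow> 'e matroid" where
  "cycle_matroid G =
    \<lparr>ground = edges G,
     indep = (\<lambda>X. X \<subseteq> edges G \<and> \<not> (\<exists>C. C \<subseteq> X \<and> is_cycle G C))\<rparr>"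

text \<open>The ground set \<open>{1,\<dots>,n}\<close> is represented by a finite type \<open>'n\<close>, so that
  \<open>real ^ 'n\<close> is the ambient space of the polytope; \<open>lab\<close> numbers its elements by
  \<open>1,\<dots>,n\<close>. The cycle has vertices \<open>0,\<dots>,k\<close>. Its edges joining \<open>i - 1\<close> and \<open>i\<close>, for
  \<open>1 \<le> i \<le> k\<close>, are numbered \<open>i\<close>; the remaining edge, joining \<open>k\<close> and \<open>0\<close>, is replaced by the
  parallel edges numbered \<open>k + 1,\<dots>,n\<close>.\<close>

definition minimal_graph :: "nat \<Rightarrow> ('n \<Rightarrow> nat) \<Rightarrow> (nat, 'n) multigraph" where
  "minimal_graph k lab =
    \<lparr>verts = {0..k}, edges = UNIV,
     ends = (\<lambda>e. if lab e \<le> k then {lab e - 1, lab e} else {k, 0})\<rparr>"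

definition minimal_matroid :: "nat \<Rightarrow> ('n \<Rightarrow> nat) \<Rightarrow> 'n matroid" where
  "minimal_matroid k lab = cycle_matroid (minimal_graph k lab)"

definition matroid_polytope :: "'n::finite matroid \<Rightarrow> (real ^ 'n) set" where
  "matroid_polytope M = convex hull {\<Sum>i\<in>B. axis i 1 | B. is_basis M B}"

definition lattice_points :: "(real ^ 'n) set \<Rightarrow> (real ^ 'n) set" where
  "lattice_points S = {x \<in> S. \<forall>i. x $ i \<in> \<int>}"

definition is_ehrhart_polynomial :: "(real ^ 'n) set \<Rightarrow> rat poly \<Rightarrow> bool" where
  "is_ehrhart_polynomial P p \<longleftrightarrow>
    (\<forall>t::nat. poly p (of_nat t) = of_nat (card (lattice_points ((\<lambda>x. real t *\<^sub>R x) ` P))))"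

definition ehrhart_polynomial :: "(real ^ 'n) set \<Rightarrow> rat poly" where
  "ehrhart_polynomial P = (THE p. is_ehrhart_polynomial P p)"

lemma is_ehrhart_polynomial_unique:
  assumes "is_ehrhart_polynomial P p" "is_ehrhart_polynomial P q"
  shows "p = q"
proof (rule ccontr)
  assume "p \<noteq> q"
  then have "finite {x. poly (p - q) x = 0}"
    by (intro poly_roots_finite) simp
  moreover have "range (of_nat :: nat \<Rightarrow> rat) \<subseteq> {x. poly (p - q) x = 0}"
    using assms by (auto simp: is_ehrhart_polynomial_def)
  ultimately have "finite (range (of_nat :: nat \<Rightarrow> rat))"
    using finite_subset by blast
  then show False
    using finite_imageD[of "of_nat :: nat \<Rightarrow> rat" UNIV] by (simp add: inj_on_def)
qed

lemma ehrhart_polynomial_eqI: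
  "is_ehrhart_polynomial P p \<Longrightarrow> ehrhart_polynomial P = p"
  unfolding ehrhart_polynomial_def using is_ehrhart_polynomial_unique by blast

text \<open>The binomial coefficient \<open>p (p - 1) \<dots> (p - m + 1) / m!\<close> as a polynomial.
  The constant \<open>gchoose\<close> is constrained to fields.\<close>

definition poly_choose :: "rat poly \<Rightarrow> nat \<Rightarrow> rat poly" where
  "poly_choose p m = smult (1 / fact m) (\<Prod>i = 0..<m. p - of_nat i)"

lemma poly_poly_choose: "poly (poly_choose p m) x = poly p x gchoose m"
  by (simp add: poly_choose_def gbinomial_prod_rev poly_prod of_nat_poly)

end

theory Submission imports Defs "HOL-Library.Multiset" begin

text \<open>
  Let \<open>P\<close> be the path of \<open>k\<close> single edges and \<open>Q\<close> the class of \<open>n - k\<close> parallel edges.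
  Since a cycle cannot cross a cut exactly once, the bases are \<open>P\<close> and the sets
  \<open>P - p + q\<close>. Hence \<open>x\<close> lies in the \<open>t\<close>-th dilate of the polytope iff \<open>x \<ge> 0\<close> and
  \<open>\<Sum>\<^bsub>P\<^esub> (t - x\<^sub>p) = \<Sum>\<^bsub>Q\<^esub> x\<^sub>q \<le> t\<close> with all \<open>t - x\<^sub>p \<ge> 0\<close>. Its lattice points are thus pairs
  of multisets on \<open>P\<close> and \<open>Q\<close> of a common size \<open>s \<le> t\<close>, and their number is
  \<open>\<Sum>\<^bsub>s\<le>t\<^esub> C(s+a, a) C(s+b, b)\<close> with \<open>a = k - 1\<close> and \<open>b = n - k - 1\<close>. Expanding each product as
  \<open>\<Sum>\<^bsub>j\<^esub> C(a, j) C(b, j) C(s+a+b-j, a+b)\<close> (induction on \<open>b\<close>) and summing over \<open>s\<close> gives the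
  formula.
\<close>

subsection \<open>Products of binomial coefficients\<close>

text \<open>Up to the factor \<open>a + b + 1\<close>, both binomials on the right are multiples of
  the one on the left, so only a polynomial identity in \<open>s\<close>, \<open>a\<close>,
  \<open>b\<close>, \<open>j\<close> remains. The factor \<open>s + b + 1\<close> is what raises
  \<open>b\<close> in the induction below.\<close>

lemma choose_mult_step:
  fixes s a b j :: nat
  assumes "j \<le> a"
  shows "(s + b + 1) * ((s + a + b - j) choose (a + b)) =
    (b + 1 + j) * ((s + a + b + 1 - j) choose (a + b + 1)) +
    (a - j) * ((s + a + b - j) choose (a + b + 1))"
proof -
  define M where "M = s + a + b - j"
  define N where "N = a + b"
  have M: "M + j = s + N" "s + a + b + 1 - j = Suc M" "s + a + b - j = M"
    using assms by (simp_all add: M_def N_def)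
  have 1: "(N + 1) * (Suc M choose (N + 1)) = (M + 1) * (M choose N)"
    using Suc_times_binomial[of N M] by simp
  have "Suc M choose (N + 1) = (M choose N) + (M choose (N + 1))"
    by simp
  then have 2: "(N + 1) * (M choose (N + 1)) + (N + 1) * (M choose N) = (M + 1) * (M choose N)"
    using 1 by (simp add: algebra_simps del: binomial_Suc_Suc)
  \<comment> \<open>Integers are used from here on because \<open>M - N\<close> equals
    \<open>s - j\<close>, which may be negative.\<close>
  define X Y Z where "X = int (M choose N)" and "Y = int (M choose (N+1))" and "Z = int (Suc M choose (N + 1))"
  have 3: "(int N + 1) * Z = (int M + 1) * X"
    using arg_cong[OF 1, of int] by (simp add: X_def Z_def algebra_simps del: binomial_Suc_Suc)
  have 4: "(int N + 1) * Y = (int M - int N) * X"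
    using arg_cong[OF 2, of int] by (simp add: X_def Y_def algebra_simps)
  have m: "int M = int s + int N - int j" "int N = int a + int b"
    using M N_def by linarith+
  have "(int N + 1) * ((int s + int b + 1) * X) = (int b + 1 + int j) * ((int M + 1) * X) + (int a - int j) * ((int M - int N) * X)"
    unfolding m by (simp add: algebra_simps)
  also have "\<dots> = (int N + 1) * ((int b + 1 + int j) * Z + (int a - int j) * Y)"
    unfolding 3[symmetric] 4[symmetric] by (simp add: algebra_simps)
  finally have "(int s + int b + 1) * X = (int b + 1 + int j) * Z + (int a - int j) * Y"
    by simp
  then have "int ((s + b + 1) * (M choose N)) = int ((b + 1 + j) * (Suc M choose (N + 1)) + (a - j) * (M choose (N+1)))"
    unfolding of_nat_mult of_nat_add of_nat_diff[OF assms] of_nat_1 X_def Y_def Z_def .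
  then show ?thesis unfolding M N_def[symmetric] of_nat_eq_iff .
qed

lemma choose_mult_choose:
  fixes s a b :: nat
  shows "((s + a) choose a) * ((s + b) choose b) =
    (\<Sum>j\<le>a. (a choose j) * (b choose j) * ((s + a + b - j) choose (a + b)))"
proof (induction b)
  case 0
  have "(\<Sum>j\<le>a. (a choose j) * (0 choose j) * ((s + a + 0 - j) choose (a + 0))) =
    (\<Sum>j\<in>{0}. (a choose j) * (0 choose j) * ((s + a + 0 - j) choose (a + 0)))"
    by (rule sum.mono_neutral_right) (auto simp: binomial_eq_0)
  then show ?case by simp
next
  case (Suc b)
  define D where "D j = (s + a + b + 1 - j) choose (a + b + 1)" for j
  \<comment> \<open>The coefficient of \<open>D j\<close> after the expansion: the summand
    \<open>j\<close> contributes with weight \<open>b + 1 + j\<close>, the summand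
    \<open>j - 1\<close> with weight \<open>a - (j - 1)\<close>. Absorption in both binomials merges
    them.\<close>
  have coeff: "(a choose j) * (b choose j) * (b + 1 + j) + (if j = 0 then 0 else (a choose (j - 1)) * (b choose (j - 1)) * (a - (j - 1)))
      = (b + 1) * ((a choose j) * (Suc b choose j))" for j
  proof (cases j)
    case (Suc i)
    have 1: "(a choose i) * (a - i) = (a choose Suc i) * Suc i"
      by (metis binomial_absorb_comp binomial_absorption mult.commute)
    have 2: "Suc b * (b choose i) = (Suc b choose Suc i) * Suc i"
      by (rule Suc_times_binomial_eq)
    have "(a choose j) * (b choose j) * (b + 1 + j) + (a choose i) * (b choose i) * (a - i)
      = (a choose j) * ((b choose j) * (b + 1 + j) + j * (b choose i))"
      using arg_cong[OF 1, of "\<lambda>u. (b choose i) * u"] by (simp add: Suc distrib_left mult_ac)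
    also have "(b choose j) * (b + 1 + j) + j * (b choose i) = (b + 1) * (Suc b choose j)"
      using 2 by (simp add: Suc algebra_simps)
    finally show ?thesis by (simp add: Suc algebra_simps)
  qed simp
  have "(b + 1) * (((s + a) choose a) * ((s + Suc b) choose Suc b)) =
    (s + b + 1) * (((s + a) choose a) * ((s + b) choose b))"
    using Suc_times_binomial[of b "s + b"] by (metis Suc_eq_plus1 add_Suc_right mult.left_commute)
  also have "\<dots> = (\<Sum>j\<le>a. (a choose j) * (b choose j) * ((s + b + 1) * ((s + a + b - j) choose (a + b))))"
    by (simp add: Suc sum_distrib_left mult_ac)
  also have "\<dots> = (\<Sum>j\<le>a. (a choose j) * (b choose j) * ((b + 1 + j) * D j + (a - j) * D (Suc j)))"
    by (intro sum.cong refl) (subst choose_mult_step, simp_all add: D_def)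
  also have "\<dots> = (\<Sum>j\<le>a. (a choose j) * (b choose j) * (b + 1 + j) * D j)
     + (\<Sum>j\<le>a. (a choose j) * (b choose j) * (a - j) * D (Suc j))"
    by (simp add: sum.distrib[symmetric] algebra_simps)
  \<comment> \<open>The summand \<open>j = a\<close> vanishes through the factor
    \<open>a - j\<close>, so the index shift that follows ends at \<open>D a\<close> and the two
    sums can be merged.\<close>
  also have "(\<Sum>j\<le>a. (a choose j) * (b choose j) * (a - j) * D (Suc j)) =
     (\<Sum>j<a. (a choose j) * (b choose j) * (a - j) * D (Suc j))"
    by (simp add: lessThan_Suc_atMost[symmetric])
  also have "\<dots> = (\<Sum>j\<le>a. (if j = 0 then 0 else (a choose (j - 1)) * (b choose (j - 1)) * (a - (j - 1))) * D j)"
    by (subst sum.atMost_shift) simp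
  also have "(\<Sum>j\<le>a. (a choose j) * (b choose j) * (b + 1 + j) * D j) + \<dots> =
     (\<Sum>j\<le>a. (b + 1) * ((a choose j) * (Suc b choose j)) * D j)"
    unfolding sum.distrib[symmetric] coeff[symmetric] by (simp add: distrib_right)
  also have "\<dots> = (b + 1) * (\<Sum>j\<le>a. (a choose j) * (Suc b choose j) * ((s + a + Suc b - j) choose (a + Suc b)))"
    unfolding sum_distrib_left by (intro sum.cong refl) (simp add: D_def mult_ac del: mult_Suc mult_Suc_right)
  finally show ?case
    by (simp only: mult_cancel1) simp
qed

text \<open>The hockey-stick identity. It may start at \<open>s = 0\<close> because for
  \<open>0 < j\<close> both sides vanish at \<open>t = 0\<close>, and for \<open>j = 0\<close> both
  are 1; \<open>j \<le> c\<close> keeps the subtraction exact.\<close>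

lemma sum_choose_shift:
  fixes t c j :: nat
  assumes "j \<le> c"
  shows "(\<Sum>s\<le>t. (s + c - j) choose c) = (t + c + 1 - j) choose (c + 1)"
proof (induction t)
  case 0
  then show ?case using assms by (cases j) (auto simp: binomial_eq_0)
next
  case (Suc t)
  have *: "Suc t + c + 1 - j = Suc (Suc t + c - j)" "t + c + 1 - j = Suc t + c - j" using assms by auto
  show ?case
    unfolding sum.atMost_Suc Suc.IH * by simp
qed

lemma sum_choose_mult_choose:
  fixes t a b :: nat
  shows "(\<Sum>s\<le>t. ((s + a) choose a) * ((s + b) choose b)) =
    (\<Sum>j\<le>a. (a choose j) * (b choose j) * ((t + a + b + 1 - j) choose (a + b + 1)))"
proof -
  have "(\<Sum>s\<le>t. ((s + a) choose a) * ((s + b) choose b)) =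
     (\<Sum>j\<le>a. (a choose j) * (b choose j) * (\<Sum>s\<le>t. (s + (a + b) - j) choose (a + b)))"
    unfolding choose_mult_choose sum_distrib_left by (subst sum.swap) (simp add: add.assoc)
  also have "\<dots> = (\<Sum>j\<le>a. (a choose j) * (b choose j) * ((t + a + b + 1 - j) choose (a + b + 1)))"
    by (intro sum.cong refl) (subst sum_choose_shift, simp_all add: add.assoc)
  finally show ?thesis .
qed

subsection \<open>Cycles and cuts\<close>

lemma is_cycle_nonempty: "is_cycle G C \<Longrightarrow> C \<noteq> {}"
  by (auto simp: is_cycle_def)

text \<open>A closed walk that leaves \<open>S\<close> has to return. If \<open>e\<close> were the
  only crossing edge, walking around the rest of the cycle from one end of \<open>e\<close> to the
  other would never change sides.\<close>

lemma is_cycle_crosses_cut_again: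
  assumes "is_cycle G C" "e \<in> C" "ends G e = {u, v}" "u \<in> S" "v \<notin> S"
  obtains e' where "e' \<in> C" "e' \<noteq> e" "ends G e' \<inter> S \<noteq> {}" "\<not> ends G e' \<subseteq> S"
proof -
  obtain vs es where c: "es \<noteq> []" "distinct es" "C = set es"
    and ends: "\<And>i. i < length es \<Longrightarrow> ends G (es ! i) = {vs ! i, vs ! (Suc i mod length es)}"
    using assms(1) unfolding is_cycle_def by blast
  define L where "L = length es"
  \<comment> \<open>The side of the \<open>i\<close>-th vertex, with the index read modulo the
    length so that the walk can pass the last vertex.\<close>
  define w where "w i \<longleftrightarrow> vs ! (i mod L) \<in> S" for i
  have L: "L > 0" using c by (simp add: L_def)
  obtain i where i: "i < L" "e = es ! i"
    using assms(2) c(3) by (metis in_set_conv_nth L_def)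
  have crossing: "w i \<noteq> w (Suc i)"
    using assms(3-5) ends[of i] i by (auto simp: w_def L_def[symmetric] doubleton_eq_iff)
  show ?thesis
  proof (rule ccontr)
    assume "\<not> thesis"
    then have no: "ends G e' \<inter> S = {} \<or> ends G e' \<subseteq> S" if "e' \<in> C" "e' \<noteq> e" for e'
      using that \<open>\<And>e'. e' \<in> C \<Longrightarrow> e' \<noteq> e \<Longrightarrow> ends G e' \<inter> S \<noteq> {} \<Longrightarrow> \<not> ends G e' \<subseteq> S \<Longrightarrow> thesis\<close> by blast
    have step: "w j = w (Suc j)" if "j mod L \<noteq> i" for j
    proof -
      have "j mod L < L" using L by simp
      then have "es ! (j mod L) \<in> C" "es ! (j mod L) \<noteq> e"
        using c that i by (auto simp: L_def nth_eq_iff_index_eq)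
      from no[OF this] show ?thesis
        using ends[of "j mod L"] \<open>j mod L < L\<close> by (auto simp: w_def L_def[symmetric] mod_Suc_eq)
    qed
    \<comment> \<open>From the end of edge \<open>i\<close>, the \<open>L - 1\<close> other edges
      lead to position \<open>i + L\<close>, which is vertex \<open>i\<close> again.\<close>
    have "w (Suc i + m) = w (Suc i)" if "m < L" for m
      using that
    proof (induction m)
      case (Suc m)
      have "(Suc i + m) mod L \<noteq> i"
      proof
        assume "(Suc i + m) mod L = i"
        then show False using i Suc.prems le_mod_geq[of L "Suc i + m"] by (cases "Suc i + m < L") auto
      qed
      from step[OF this] show ?case using Suc by simp
    qed simp
    from this[of "L - 1"] have "w (i + L) = w (Suc i)" using L by simp
    then show False using crossing by (simp add: w_def)
  qed
qed

section \<open>Coordinates of incidence vectors and sizes of multisets\<close>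

lemma sum_axis_component:
  "(\<Sum>i\<in>B. axis i (1::real) $ (e::'n::finite)) = of_bool (e \<in> B)"
  by (simp add: axis_def sum.delta)

lemma size_eq_sum_count:
  assumes "finite A" "set_mset M \<subseteq> A"
  shows "size M = (\<Sum>e\<in>A. count M e)"
  unfolding size_multiset_overloaded_eq
  using assms by (intro sum.mono_neutral_left) (auto simp: count_eq_zero_iff)

subsection \<open>Bases of the minimal matroid\<close>

locale minimal_labelling =
  fixes k n :: nat and lab :: "'n::finite \<Rightarrow> nat"
  assumes k_pos: "1 \<le> k" and k_less: "k < n" and lab_bij: "bij_betw lab UNIV {1..n}"
begin

text \<open>These two sets are the \<open>P\<close> and \<open>Q\<close> of the overview.\<close>

definition path_edges :: "'n set" where "path_edges = {e. lab e \<le> k}"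
definition parallel_edges :: "'n set" where "parallel_edges = {e. k < lab e}"

abbreviation G where "G \<equiv> minimal_graph k lab"
abbreviation M where "M \<equiv> minimal_matroid k lab"

lemma lab_range: "Suc 0 \<le> lab e" "lab e \<le> n"
  using bij_betwE[OF lab_bij] by auto

lemma lab_eq_iff: "lab e = lab f \<longleftrightarrow> e = f"
  using lab_bij by (auto simp: bij_betw_def inj_eq)

lemma edge_cases: "e \<in> path_edges \<or> e \<in> parallel_edges"
  by (auto simp: path_edges_def parallel_edges_def)

lemma parallel_edges_iff: "e \<in> parallel_edges \<longleftrightarrow> e \<notin> path_edges"
  by (auto simp: path_edges_def parallel_edges_def)

lemma bij_betw_subset_preimage:
  assumes "A = {e. lab e \<in> I}" "I \<subseteq> {1..n}"
  shows "bij_betw lab A I"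
proof (rule bij_betw_imageI)
  show "inj_on lab A" by (simp add: inj_on_def lab_eq_iff)
  have "I \<subseteq> range lab" using assms(2) lab_bij by (simp add: bij_betw_def)
  then show "lab ` A = I" using assms(1) by auto
qed

lemma bij_lab_path: "bij_betw lab path_edges {1..k}"
  by (rule bij_betw_subset_preimage) (use k_less in \<open>auto simp: path_edges_def lab_range\<close>)

lemma bij_lab_parallel: "bij_betw lab parallel_edges {k+1..n}"
  by (rule bij_betw_subset_preimage) (auto simp: parallel_edges_def lab_range)

lemma card_path_edges: "card path_edges = k"
  using bij_betw_same_card[OF bij_lab_path] by simp

lemma card_parallel_edges: "card parallel_edges = n - k"
  using bij_betw_same_card[OF bij_lab_parallel] by simp

lemma parallel_pair_is_cycle:
  assumes "q \<in> parallel_edges" "q' \<in> parallel_edges" "q \<noteq> q'"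
  shows "is_cycle G {q, q'}"
  unfolding is_cycle_def
  using assms k_pos
  \<comment> \<open>A cycle of length 2; its two vertices differ because
    \<open>1 \<le> k\<close>.\<close>
  by (intro exI[of _ "[k, 0]"] exI[of _ "[q, q']"])
     (auto simp: minimal_graph_def parallel_edges_def less_Suc_eq insert_commute)

lemma path_closed_is_cycle:
  assumes "q \<in> parallel_edges"
  shows "is_cycle G (insert q path_edges)"
proof -
  define p where "p = inv_into path_edges lab"
  have p: "p i \<in> path_edges" "lab (p i) = i" if "1 \<le> i" "i \<le> k" for i
    using that bij_lab_path unfolding p_def bij_betw_def
    by (auto intro!: inv_into_into f_inv_into_f)
  \<comment> \<open>Labels start at 1 and positions at 0, so position \<open>i\<close> holds the
    edge from \<open>i\<close> to \<open>i + 1\<close>. The edge \<open>q\<close> comes last and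
    closes the walk from \<open>k\<close> to 0.\<close>
  define es where "es = map (\<lambda>i. p (Suc i)) [0..<k] @ [q]"
  have nth: "es ! i = (if i < k then p (Suc i) else q)" if "i \<le> k" for i
    using that by (auto simp: es_def nth_append)
  have "inj_on (\<lambda>i. p (Suc i)) {0..<k}"
    by (rule inj_onI) (metis p(2) Suc_le_eq atLeastLessThan_iff diff_Suc_1 le_add1 plus_1_eq_Suc)
  moreover have "q \<notin> (\<lambda>i. p (Suc i)) ` {0..<k}"
    using p assms by (auto simp: parallel_edges_iff)
  ultimately have dist: "distinct es"
    by (auto simp: es_def distinct_map)
  have "path_edges \<subseteq> (\<lambda>i. p (Suc i)) ` {0..<k}"
  proof
    fix e assume e: "e \<in> path_edges"
    then have "1 \<le> lab e" "lab e \<le> k" using lab_range by (auto simp: path_edges_def)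
    then have "e = p (Suc (lab e - 1))" using p(2)[of "lab e"] by (simp add: lab_eq_iff)
    then show "e \<in> (\<lambda>i. p (Suc i)) ` {0..<k}" using \<open>1 \<le> lab e\<close> \<open>lab e \<le> k\<close> by (intro image_eqI[of _ _ "lab e - 1"]) auto
  qed
  then have set: "set es = insert q path_edges"
    using p by (fastforce simp: es_def)
  have "\<forall>i<length es. ends G (es ! i) = {[0..<Suc k] ! i, [0..<Suc k] ! (Suc i mod length es)}"
  proof (intro allI impI)
    fix i assume "i < length es"
    then consider "i < k" | "i = k" by (fastforce simp: es_def less_Suc_eq)
    then show "ends G (es ! i) = {[0..<Suc k] ! i, [0..<Suc k] ! (Suc i mod length es)}"
    proof cases
      case 1
      then have [simp]: "lab (p (Suc i)) = Suc i" by (intro p) auto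
      have "ends G (es ! i) = {i, Suc i}" using 1 nth[of i] by (simp add: minimal_graph_def)
      moreover have "length es = Suc k" by (simp add: es_def)
      ultimately show ?thesis using 1 by (simp del: upt_Suc)
    next
      case 2
      then show ?thesis using nth[of i] assms
        by (simp add: minimal_graph_def parallel_edges_def es_def del: upt_Suc)
    qed
  qed
  then show ?thesis unfolding is_cycle_def
    using dist set
    by (intro exI[of _ "[0..<Suc k]"] exI[of _ es])
      (auto simp: minimal_graph_def es_def simp del: upt_Suc)
qed

text \<open>If \<open>p\<close> joins \<open>i\<close> and \<open>i + 1\<close>, it is the only path
  edge across the cut \<open>{..i}\<close>, so the second crossing edge must be parallel. Hence the
  path alone contains no cycle.\<close>

lemma cycle_containing_path_edge:
  assumes C: "is_cycle G C" and p: "p \<in> C" "p \<in> path_edges"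
  shows "C \<inter> parallel_edges \<noteq> {}"
proof -
  define i where "i = lab p - 1"
  have lab: "lab p = Suc i" using lab_range(1)[of p] by (simp add: i_def)
  then have "ends G p = {i, Suc i}"
    using p(2) by (simp add: minimal_graph_def path_edges_def)
  then obtain e where e: "e \<in> C" "e \<noteq> p" "ends G e \<inter> {..i} \<noteq> {}" "\<not> ends G e \<subseteq> {..i}"
    using is_cycle_crosses_cut_again[OF C p(1), of i "Suc i" "{..i}"] by auto
  have "e \<notin> path_edges"
  proof
    assume "e \<in> path_edges"
    then have "lab e - 1 \<le> i" "\<not> lab e \<le> i" using e(3,4)
      by (auto simp: minimal_graph_def path_edges_def split: if_splits)
    then have "lab e = lab p" using lab by simp
    then show False using e(2) lab_eq_iff by simp
  qed
  then show ?thesis using e(1) by (auto simp: parallel_edges_iff)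
qed

text \<open>The same cut at the missing edge \<open>p\<close>: \<open>q\<close> crosses it because 0
  lies inside and \<open>k\<close> outside, and the only path edge that could cross back is
  absent.\<close>

lemma cycle_containing_parallel_edge:
  assumes C: "is_cycle G C" and q: "q \<in> C" "q \<in> parallel_edges" and p: "p \<in> path_edges" "p \<notin> C"
  shows "\<exists>q'\<in>C. q' \<in> parallel_edges \<and> q' \<noteq> q"
proof -
  define i where "i = lab p - 1"
  have lab: "lab p = Suc i" using lab_range(1)[of p] by (simp add: i_def)
  have "i < k" using p lab by (simp add: path_edges_def)
  have "ends G q = {0, k}"
    using q(2) by (auto simp: minimal_graph_def parallel_edges_def)
  then obtain e where e: "e \<in> C" "e \<noteq> q" "ends G e \<inter> {..i} \<noteq> {}" "\<not> ends G e \<subseteq> {..i}"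
    using is_cycle_crosses_cut_again[OF C q(1), of 0 k "{..i}"] \<open>i < k\<close>
    by (metis atMost_iff le0 not_le)
  have "e \<notin> path_edges"
  proof
    assume "e \<in> path_edges"
    then have "lab e - 1 \<le> i" "\<not> lab e \<le> i" using e(3,4)
      by (auto simp: minimal_graph_def path_edges_def split: if_splits)
    then have "lab e = lab p" using lab by simp
    then show False using e(1) p(2) lab_eq_iff by simp
  qed
  then show ?thesis using e(1,2) by (auto simp: parallel_edges_iff)
qed

text \<open>One direction uses the two explicit kinds of cycle. For the other, a cycle in
  \<open>X\<close> contains some parallel edge, hence misses a path edge, hence contains a second
  parallel edge.\<close>

lemma indep_iff:
  "indep M X \<longleftrightarrow> (\<forall>q\<in>X \<inter> parallel_edges. X \<inter> parallel_edges = {q} \<and> \<not> path_edges \<subseteq> X)"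
proof
  assume ind: "indep M X"
  have no: "\<not> is_cycle G C" if "C \<subseteq> X" for C
    using ind that by (auto simp: minimal_matroid_def cycle_matroid_def)
  show "\<forall>q\<in>X \<inter> parallel_edges. X \<inter> parallel_edges = {q} \<and> \<not> path_edges \<subseteq> X"
  proof
    fix q assume q: "q \<in> X \<inter> parallel_edges"
    have "q' = q" if "q' \<in> X \<inter> parallel_edges" for q'
      using no[of "{q', q}"] parallel_pair_is_cycle[of q' q] q that by blast
    moreover have "\<not> path_edges \<subseteq> X"
      using no[of "insert q path_edges"] path_closed_is_cycle[of q] q by blast
    ultimately show "X \<inter> parallel_edges = {q} \<and> \<not> path_edges \<subseteq> X" using q by blast
  qed
next
  assume *: "\<forall>q\<in>X \<inter> parallel_edges. X \<inter> parallel_edges = {q} \<and> \<not> path_edges \<subseteq> X"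
  have False if C: "C \<subseteq> X" "is_cycle G C" for C
  proof -
    obtain e where "e \<in> C" using is_cycle_nonempty[OF C(2)] by auto
    then obtain q where q: "q \<in> C" "q \<in> parallel_edges"
      using cycle_containing_path_edge[OF C(2)] edge_cases by blast
    then obtain p where "p \<in> path_edges" "p \<notin> C" using * C(1) by blast
    then obtain q' where "q' \<in> C" "q' \<in> parallel_edges" "q' \<noteq> q"
      using cycle_containing_parallel_edge[OF C(2) q] by blast
    then show False using * q C(1) by blast
  qed
  then show "indep M X"
    by (auto simp: minimal_matroid_def cycle_matroid_def minimal_graph_def)
qed

lemma is_basis_iff:
  "is_basis M B \<longleftrightarrow> B = path_edges \<or>
    (\<exists>p\<in>path_edges. \<exists>q\<in>parallel_edges. B = insert q (path_edges - {p}))"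
proof -
  have basis: "is_basis M B \<longleftrightarrow> indep M B \<and> (\<forall>X. B \<subseteq> X \<and> indep M X \<longrightarrow> X = B)" for B
    by (simp add: is_basis_def minimal_matroid_def cycle_matroid_def minimal_graph_def)
  have ind: "indep M path_edges"
    by (auto simp: indep_iff parallel_edges_iff)
  have ind': "indep M (insert q (path_edges - {p}))" if "p \<in> path_edges" "q \<in> parallel_edges" for p q
    using that by (auto simp: indep_iff parallel_edges_iff)
  have "is_basis M path_edges"
    unfolding basis
  proof (intro conjI allI impI ind)
    fix X assume X: "path_edges \<subseteq> X \<and> indep M X"
    then have "X \<inter> parallel_edges = {}" unfolding indep_iff by blast
    then show "X = path_edges" using X edge_cases by blast
  qed
  moreover have "is_basis M (insert q (path_edges - {p}))"
    if pq: "p \<in> path_edges" "q \<in> parallel_edges" for p q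
    unfolding basis
  proof (intro conjI allI impI ind' pq)
    fix X assume X: "insert q (path_edges - {p}) \<subseteq> X \<and> indep M X"
    then have "X \<inter> parallel_edges = {q}" "\<not> path_edges \<subseteq> X" using pq unfolding indep_iff by blast+
    then show "X = insert q (path_edges - {p})" using X edge_cases by blast
  qed
  \<comment> \<open>Every independent set lies in one of the listed sets, so a maximal one equals
    it.\<close>
  moreover have "B = path_edges \<or> (\<exists>p\<in>path_edges. \<exists>q\<in>parallel_edges. B = insert q (path_edges - {p}))"
    if B: "indep M B" and max: "\<And>X. B \<subseteq> X \<Longrightarrow> indep M X \<Longrightarrow> X = B"
  proof (cases "B \<inter> parallel_edges = {}")
    case True
    then have "B \<subseteq> path_edges" using edge_cases by blast
    then show ?thesis using max ind by blast
  next
    case False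
    then obtain q where q: "B \<inter> parallel_edges = {q}" "\<not> path_edges \<subseteq> B"
      using B unfolding indep_iff by blast
    then obtain p where p: "p \<in> path_edges" "p \<notin> B" by auto
    have "q \<in> parallel_edges" using q by auto
    have "B \<subseteq> insert q (path_edges - {p})" using q p edge_cases by blast
    then show ?thesis using max[OF _ ind'] p \<open>q \<in> parallel_edges\<close> by blast
  qed
  ultimately show ?thesis using basis[of B] by blast
qed

subsection \<open>The matroid polytope and its dilates\<close>

text \<open>An inequality description of the \<open>t\<close>-th dilate. The equation says that all
  coordinates sum to \<open>k * t\<close>; written with the deficits \<open>t - x $ p\<close>, it
  exhibits the common value \<open>s\<close> that is later summed over.\<close>

definition scaled_constraints :: "real \<Rightarrow> (real ^ 'n) set" where
  "scaled_constraints t = {x. (\<forall>e. 0 \<le> x $ e) \<and> (\<forall>p\<in>path_edges. x $ p \<le> t) \<and>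
     (\<Sum>p\<in>path_edges. t - x $ p) = (\<Sum>q\<in>parallel_edges. x $ q) \<and>
     (\<Sum>q\<in>parallel_edges. x $ q) \<le> t}"

lemma convex_scaled_constraints: "convex (scaled_constraints t)"
proof (rule convexI)
  fix x y :: "real ^ 'n" and u v :: real
  assume x: "x \<in> scaled_constraints t" and y: "y \<in> scaled_constraints t"
    and uv: "0 \<le> u" "0 \<le> v" "u + v = 1"
  let ?w = "u *\<^sub>R x + v *\<^sub>R y"
  have sumQ: "(\<Sum>q\<in>parallel_edges. ?w $ q) =
      u * (\<Sum>q\<in>parallel_edges. x $ q) + v * (\<Sum>q\<in>parallel_edges. y $ q)"
    by (simp add: sum.distrib sum_distrib_left)
  have "t - ?w $ p = u * (t - x $ p) + v * (t - y $ p)" for p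
    using uv(3) by (simp add: right_diff_distrib) (metis distrib_right mult_1)
  then have sumP: "(\<Sum>p\<in>path_edges. t - ?w $ p) =
      u * (\<Sum>p\<in>path_edges. t - x $ p) + v * (\<Sum>p\<in>path_edges. t - y $ p)"
    by (simp only: sum.distrib sum_distrib_left)
  show "?w \<in> scaled_constraints t"
    unfolding scaled_constraints_def mem_Collect_eq sumP sumQ
    using x y uv by (auto simp: scaled_constraints_def intro!: convex_bound_le)
qed

lemma path_vertex: "(\<Sum>i\<in>path_edges. axis i 1) \<in> matroid_polytope M"
  unfolding matroid_polytope_def by (intro hull_inc) (auto simp: is_basis_iff)

lemma exchange_vertex:
  assumes "p \<in> path_edges" "q \<in> parallel_edges"
  shows "(\<Sum>i\<in>insert q (path_edges - {p}). axis i 1) \<in> matroid_polytope M"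
  unfolding matroid_polytope_def using assms by (intro hull_inc) (auto simp: is_basis_iff)

lemma matroid_polytope_subset: "matroid_polytope M \<subseteq> scaled_constraints 1"
  unfolding matroid_polytope_def
proof (rule hull_minimal)
  show "{\<Sum>i\<in>B. axis i 1 |B. is_basis M B} \<subseteq> scaled_constraints 1"
  proof clarify
    fix B assume "is_basis M B"
    then consider "B = path_edges"
      | p q where "p \<in> path_edges" "q \<in> parallel_edges" "B = insert q (path_edges - {p})"
      unfolding is_basis_iff by blast
    then show "(\<Sum>i\<in>B. axis i 1) \<in> scaled_constraints 1"
    proof cases
      case 1
      then show ?thesis
        by (simp add: scaled_constraints_def sum_axis_component parallel_edges_iff)
    next
      case 2
      \<comment> \<open>Only \<open>p\<close> has a deficit and only \<open>q\<close> a positive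
        coordinate in the parallel class, so both sums are 1.\<close>
      have "(\<Sum>e\<in>path_edges. 1 - of_bool (e \<in> B)) = (\<Sum>e\<in>path_edges. if e = p then 1 else (0::real))"
        using 2 by (intro sum.cong) (auto simp: parallel_edges_iff)
      moreover have "(\<Sum>e\<in>parallel_edges. of_bool (e \<in> B)) = (\<Sum>e\<in>parallel_edges. if e = q then 1 else (0::real))"
        using 2 by (intro sum.cong) (auto simp: parallel_edges_iff)
      ultimately show ?thesis
        using 2(1,2) by (simp add: scaled_constraints_def sum_axis_component sum.delta)
    qed
  qed
qed (rule convex_scaled_constraints)

text \<open>A point with total deficit \<open>s > 0\<close> is \<open>1 - s\<close> times the vertex
  of the path plus \<open>s\<close> times a convex combination of exchange vertices; with
  \<open>s = 0\<close> it is the path vertex itself.\<close>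

lemma scaled_constraints_subset: "scaled_constraints 1 \<subseteq> matroid_polytope M"
proof
  fix x assume x: "x \<in> scaled_constraints 1"
  define s where "s = (\<Sum>q\<in>parallel_edges. x $ q)"
  have s: "(\<Sum>p\<in>path_edges. 1 - x $ p) = s" "0 \<le> s" "s \<le> 1"
    using x by (auto simp: scaled_constraints_def s_def intro: sum_nonneg)
  have x_nonneg: "0 \<le> x $ e" for e using x by (simp add: scaled_constraints_def)
  have x_le: "x $ p \<le> 1" if "p \<in> path_edges" for p using x that by (simp add: scaled_constraints_def)
  let ?P = "\<Sum>i\<in>path_edges. axis i 1 :: real ^ 'n"
  let ?v = "\<lambda>(p, q). \<Sum>i\<in>insert q (path_edges - {p}). axis i 1 :: real ^ 'n"
  show "x \<in> matroid_polytope M"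
  proof (cases "s = 0")
    case True
    have "x $ p = 1" if "p \<in> path_edges" for p
      using s(1) x_le that unfolding True by (subst (asm) sum_nonneg_eq_0_iff) auto
    moreover have "x $ q = 0" if "q \<in> parallel_edges" for q
      using True x_nonneg that unfolding s_def by (subst (asm) sum_nonneg_eq_0_iff) auto
    ultimately have "x = ?P"
      by (auto simp: vec_eq_iff sum_axis_component parallel_edges_iff)
    then show ?thesis using path_vertex by simp
  next
    case False
    then have "s > 0" using s by simp
    text \<open>Move the deficit \<open>1 - x\<^sub>p\<close> on the path to the parallel class proportionally to \<open>x\<^sub>q\<close>.\<close>
    define w where "w = (\<lambda>(p, q). (1 - x $ p) * x $ q / s\<^sup>2)"
    define y where "y = (\<Sum>pq\<in>path_edges \<times> parallel_edges. w pq *\<^sub>R ?v pq)"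
    \<comment> \<open>The marginals of \<open>w\<close>, which determine the coordinates of
      \<open>y\<close>. Deficits and parallel coordinates both have total \<open>s\<close>, whence
      the normalisation by \<open>s\<^sup>2\<close>.\<close>
    have w_left: "(\<Sum>p\<in>path_edges. w (p, q)) = x $ q / s" for q
      using \<open>s > 0\<close> s(1) by (simp add: w_def power2_eq_square flip: sum_divide_distrib sum_distrib_right)
    have w_right: "(\<Sum>q\<in>parallel_edges. w (p, q)) = (1 - x $ p) / s" for p
      using \<open>s > 0\<close> by (simp add: w_def power2_eq_square s_def[symmetric] flip: sum_divide_distrib sum_distrib_left)
    have w_sum: "(\<Sum>pq\<in>path_edges \<times> parallel_edges. w pq) = 1"
      using \<open>s > 0\<close> s(1) by (simp add: sum.cartesian_product' w_right flip: sum_divide_distrib)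
    have "y \<in> matroid_polytope M"
      unfolding y_def
    proof (rule convex_sum[OF _ _ w_sum])
      show "convex (matroid_polytope M)" by (simp add: matroid_polytope_def)
      show "0 \<le> w pq" if "pq \<in> path_edges \<times> parallel_edges" for pq
        using that x_le x_nonneg by (auto simp: w_def)
      show "?v pq \<in> matroid_polytope M" if "pq \<in> path_edges \<times> parallel_edges" for pq
        using that exchange_vertex by auto
    qed simp
    moreover have "x = (1 - s) *\<^sub>R ?P + s *\<^sub>R y"
    proof (rule vec_eq_iff[THEN iffD2], rule allI)
      fix e
      have y: "y $ e = (\<Sum>p\<in>path_edges. \<Sum>q\<in>parallel_edges.
           w (p, q) * of_bool (e = q \<or> e \<in> path_edges \<and> e \<noteq> p))"
        by (simp add: y_def sum.cartesian_product' sum_axis_component)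
      show "x $ e = ((1 - s) *\<^sub>R ?P + s *\<^sub>R y) $ e"
      proof (cases "e \<in> path_edges")
        case True
        \<comment> \<open>On the path, \<open>e\<close> is absent from exactly the vertices with
          \<open>p = e\<close>, so \<open>y $ e\<close> is
          \<open>1 - (1 - x $ e) / s\<close>.\<close>
        then have "e \<noteq> q" if "q \<in> parallel_edges" for q using that by (auto simp: parallel_edges_iff)
        then have "y $ e = (\<Sum>p\<in>path_edges. \<Sum>q\<in>parallel_edges. w (p, q) * of_bool (e \<noteq> p))"
          unfolding y using True by (intro sum.cong) auto
        also have "\<dots> = (\<Sum>p\<in>path_edges. (1 - x $ p) / s * of_bool (e \<noteq> p))"
          by (simp add: w_right flip: sum_distrib_right)
        also have "\<dots> = (\<Sum>p\<in>path_edges. (1 - x $ p) / s - (if p = e then (1 - x $ e) / s else 0))"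
          by (intro sum.cong) auto
        also have "\<dots> = s / s - (1 - x $ e) / s"
          using True s(1) by (simp add: sum_subtractf sum.delta flip: sum_divide_distrib)
        finally show ?thesis using True \<open>s > 0\<close>
          by (simp add: sum_axis_component field_simps)
      next
        case False
        then have "y $ e = (\<Sum>p\<in>path_edges. \<Sum>q\<in>parallel_edges. if q = e then w (p, e) else 0)"
          unfolding y by (intro sum.cong) auto
        also have "\<dots> = x $ e / s"
          using False by (simp add: sum.delta parallel_edges_iff w_left)
        finally show ?thesis using False \<open>s > 0\<close> by (simp add: sum_axis_component)
      qed
    qed
    ultimately show ?thesis
      using convexD[OF _ path_vertex, of y "1 - s" s] s by (simp add: matroid_polytope_def)
  qed
qed

lemma scaled_matroid_polytope:
  fixes t :: nat
  shows "(\<lambda>x. real t *\<^sub>R x) ` matroid_polytope M = scaled_constraints (real t)"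
proof -
  have *: "matroid_polytope M = scaled_constraints 1"
    using matroid_polytope_subset scaled_constraints_subset by blast
  have scale: "c *\<^sub>R x \<in> scaled_constraints (c * u)" if "x \<in> scaled_constraints u" "0 \<le> c" for c u x
    using that by (auto simp: scaled_constraints_def mult_left_mono simp flip: sum_distrib_left right_diff_distrib)
  show ?thesis
  \<comment> \<open>For \<open>t > 0\<close> scaling by \<open>1 / t\<close> inverts the dilation.
    For \<open>t = 0\<close> the constraints must be seen to leave only the origin.\<close>
  proof (cases "t = 0")
    case True
    have "x = 0" if x: "x \<in> scaled_constraints 0" for x
    proof -
      have nn: "0 \<le> x $ e" for e using x by (simp add: scaled_constraints_def)
      have "(\<Sum>q\<in>parallel_edges. x $ q) = 0"
        using x nn by (auto simp: scaled_constraints_def intro!: antisym sum_nonneg)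
      then have "x $ q = 0" if "q \<in> parallel_edges" for q
        using that nn by (subst (asm) sum_nonneg_eq_0_iff) auto
      moreover have "x $ p = 0" if "p \<in> path_edges" for p
        using x nn[of p] that by (intro antisym) (auto simp: scaled_constraints_def)
      ultimately show "x = 0" using edge_cases by (metis vec_eq_iff zero_index)
    qed
    moreover have "0 \<in> scaled_constraints 0" by (simp add: scaled_constraints_def)
    ultimately show ?thesis using path_vertex True by auto
  next
    case False
    have "x \<in> (\<lambda>x. real t *\<^sub>R x) ` scaled_constraints 1" if "x \<in> scaled_constraints (real t)" for x
      using scale[OF that, of "1 / t"] False by (intro image_eqI[of _ _ "(1 / t) *\<^sub>R x"]) auto
    then show ?thesis using scale[of _ 1 "real t"] by (auto simp: *)
  qed
qed

subsection \<open>Counting lattice points\<close>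

text \<open>On the path the multiset \<open>z\<close> records deficits, not coordinates, so that
  \<open>z\<close> and \<open>y\<close> have the same size \<open>s\<close>.\<close>

definition lattice_point_of :: "nat \<Rightarrow> nat \<times> 'n multiset \<times> 'n multiset \<Rightarrow> real ^ 'n" where
  "lattice_point_of t = (\<lambda>(s, z, y). \<chi> e. if e \<in> path_edges then real t - count z e else count y e)"

lemma bij_betw_lattice_point_of:
  "bij_betw (lattice_point_of t)
    (SIGMA s:{..t}. multisets_of_size path_edges s \<times> multisets_of_size parallel_edges s)
    (lattice_points (scaled_constraints (real t)))" (is "bij_betw _ ?A ?B")
proof (rule bij_betw_imageI)
  show "inj_on (lattice_point_of t) ?A"
  proof (rule inj_onI)
    fix u u' assume u: "u \<in> ?A" "u' \<in> ?A" and uu': "lattice_point_of t u = lattice_point_of t u'"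
    obtain s z y s' z' y' where u_def: "u = (s, z, y)" "u' = (s', z', y')"
      by (metis prod_cases3)
    have z: "z \<in> multisets_of_size path_edges s" "z' \<in> multisets_of_size path_edges s'"
      and y: "y \<in> multisets_of_size parallel_edges s" "y' \<in> multisets_of_size parallel_edges s'"
      and eq: "lattice_point_of t (s, z, y) = lattice_point_of t (s', z', y')"
      using u uu' by (auto simp: u_def)
    have e: "lattice_point_of t (s, z, y) $ e = lattice_point_of t (s', z', y') $ e" for e
      using eq by simp
    have "count z e = count z' e" for e
    proof (cases "e \<in> path_edges")
      case False
      then have "e \<notin># z" "e \<notin># z'" using z by (auto simp: multisets_of_size_def)
      then show ?thesis by (simp add: not_in_iff)
    qed (use e[of e] in \<open>simp add: lattice_point_of_def\<close>)
    then have "z = z'" by (rule multiset_eqI)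
    moreover have "count y e = count y' e" for e
    proof (cases "e \<in> path_edges")
      case True
      then have "e \<notin># y" "e \<notin># y'" using y by (auto simp: multisets_of_size_def parallel_edges_iff)
      then show ?thesis by (simp add: not_in_iff)
    qed (use e[of e] in \<open>simp add: lattice_point_of_def\<close>)
    then have "y = y'" by (rule multiset_eqI)
    ultimately show "u = u'" using z by (simp add: u_def multisets_of_size_def)
  qed
  show "lattice_point_of t ` ?A = ?B"
  proof (intro equalityI subsetI)
    fix x assume "x \<in> lattice_point_of t ` ?A"
    then obtain s z y where x: "x = lattice_point_of t (s, z, y)" and s: "s \<le> t"
      and z: "set_mset z \<subseteq> path_edges" "size z = s" and y: "set_mset y \<subseteq> parallel_edges" "size y = s"
      by (auto simp: multisets_of_size_def)
    have P: "x $ p = real t - count z p" if "p \<in> path_edges" for p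
      using that by (simp add: x lattice_point_of_def)
    have Q: "x $ q = count y q" if "q \<in> parallel_edges" for q
      using that by (simp add: x lattice_point_of_def parallel_edges_iff)
    \<comment> \<open>A multiplicity is at most the size \<open>s \<le> t\<close>, which makes the
      path coordinates nonnegative.\<close>
    have "count z p \<le> t" for p
      using count_le_size[of z p] z s by linarith
    then have "0 \<le> x $ e" "x $ e \<in> \<int>" for e
      using edge_cases[of e] by (auto simp: P Q)
    moreover have "(\<Sum>p\<in>path_edges. real t - x $ p) = real s"
      using size_eq_sum_count[OF _ z(1)] z(2) by (simp add: P flip: of_nat_sum)
    moreover have "(\<Sum>q\<in>parallel_edges. x $ q) = real s"
      using size_eq_sum_count[OF _ y(1)] y(2) by (simp add: Q flip: of_nat_sum)
    ultimately show "x \<in> ?B" using s by (auto simp: lattice_points_def scaled_constraints_def P)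
  next
    fix x assume x: "x \<in> ?B"
    have int: "real_of_int \<lfloor>x $ e\<rfloor> = x $ e" for e
      using x by (auto simp: lattice_points_def)
    have nn: "0 \<le> x $ e" for e using x by (simp add: lattice_points_def scaled_constraints_def)
    have le: "x $ p \<le> t" if "p \<in> path_edges" for p
      using x that by (simp add: lattice_points_def scaled_constraints_def)
    \<comment> \<open>The multisets are read off from the coordinates. The value 0 confines each
      support to its own edge class, and \<open>nat\<close> loses nothing because
      \<open>0 \<le> x $ e\<close>, and \<open>x $ e \<le> t\<close> on the path.\<close>
    define z where "z = Abs_multiset (\<lambda>e. if e \<in> path_edges then nat (int t - \<lfloor>x $ e\<rfloor>) else 0)"
    define y where "y = Abs_multiset (\<lambda>e. if e \<in> path_edges then 0 else nat \<lfloor>x $ e\<rfloor>)"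
    have cz: "count z e = (if e \<in> path_edges then nat (int t - \<lfloor>x $ e\<rfloor>) else 0)" for e
      unfolding z_def by (subst count_Abs_multiset) auto
    have cy: "count y e = (if e \<in> path_edges then 0 else nat \<lfloor>x $ e\<rfloor>)" for e
      unfolding y_def by (subst count_Abs_multiset) auto
    have z: "set_mset z \<subseteq> path_edges" and y: "set_mset y \<subseteq> parallel_edges"
      using cz cy by (auto simp: parallel_edges_iff set_mset_def split: if_splits)
    have czr: "real (count z e) = t - x $ e" if "e \<in> path_edges" for e
    proof -
      have "\<lfloor>x $ e\<rfloor> \<le> int t" using le[OF that] int[of e] by linarith
      then show ?thesis using that int[of e] by (simp add: cz)
    qed
    have cyr: "real (count y e) = x $ e" if "e \<notin> path_edges" for e
      using that int[of e] nn[of e] by (simp add: cy)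
    have sz: "real (size z) = (\<Sum>p\<in>path_edges. real t - x $ p)"
      using size_eq_sum_count[OF _ z] by (simp add: czr)
    have sy: "real (size y) = (\<Sum>q\<in>parallel_edges. x $ q)"
      using size_eq_sum_count[OF _ y] by (simp add: cyr parallel_edges_iff)
    have "real (size z) = real (size y)" "real (size y) \<le> real t"
      using x unfolding sz sy by (simp_all add: lattice_points_def scaled_constraints_def)
    then have "(size y, z, y) \<in> ?A" using z y by (simp add: multisets_of_size_def)
    moreover have "x = lattice_point_of t (size y, z, y)"
      by (simp add: lattice_point_of_def vec_eq_iff czr cyr)
    ultimately show "x \<in> lattice_point_of t ` ?A" by blast
  qed
qed

lemma card_lattice_points:
  "card (lattice_points ((\<lambda>x. real t *\<^sub>R x) ` matroid_polytope M)) =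
    (\<Sum>j\<le>k - 1. ((k - 1) choose j) * ((n - k - 1) choose j) * ((t + n - 1 - j) choose (n - 1)))"
proof -
  \<comment> \<open>Multisets of size \<open>s\<close> on \<open>a + 1\<close> elements number
    \<open>(s + a) choose a\<close>, hence one less than each class size.\<close>
  define a b where "a = k - 1" and "b = n - k - 1"
  have ab: "k = Suc a" "n - k = Suc b" "n - 1 = a + b + 1" "n = a + b + 2"
    using k_pos k_less by (auto simp: a_def b_def)
  have "card (lattice_points ((\<lambda>x. real t *\<^sub>R x) ` matroid_polytope M)) =
     card (SIGMA s:{..t}. multisets_of_size path_edges s \<times> multisets_of_size parallel_edges s)"
    unfolding scaled_matroid_polytope using bij_betw_same_card[OF bij_betw_lattice_point_of] by simp
  also have "\<dots> = (\<Sum>s\<le>t. card (multisets_of_size path_edges s) * card (multisets_of_size parallel_edges s))"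
    by (subst card_SigmaI) (auto simp: card_cartesian_product finite_multisets_of_size)
  also have "\<dots> = (\<Sum>s\<le>t. ((s + a) choose a) * ((s + b) choose b))"
  proof -
    have "card path_edges = Suc a" "card parallel_edges = Suc b"
      using card_path_edges card_parallel_edges ab by simp_all
    then show ?thesis
      by (simp add: card_multisets_of_size binomial_symmetric[of a] binomial_symmetric[of b] add.commute)
  qed
  also have "\<dots> = (\<Sum>j\<le>a. (a choose j) * (b choose j) * ((t + a + b + 1 - j) choose (a + b + 1)))"
    by (rule sum_choose_mult_choose)
  finally show ?thesis by (simp add: ab add.assoc)
qed

end

section \<open>The Ehrhart polynomial\<close>

theorem theorem3p1:
  fixes k n :: nat and lab :: "'n::finite \<Rightarrow> nat"
  assumes "1 \<le> k" and "k \<le> n - 1"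
    and "bij_betw lab UNIV {1..n}"
  shows "ehrhart_polynomial (matroid_polytope (minimal_matroid k lab)) =
    (\<Sum>j = 0..k - 1. of_nat ((k - 1) choose j) * of_nat ((n - k - 1) choose j) *
       poly_choose ([:0, 1:] + of_nat n - 1 - of_nat j) (n - 1))"
proof -
  interpret minimal_labelling k n lab
    using assms by unfold_locales auto
  show ?thesis
  proof (rule ehrhart_polynomial_eqI, unfold is_ehrhart_polynomial_def, rule allI)
    fix t :: nat
    \<comment> \<open>Since \<open>j \<le> k - 1 < n - 1\<close>, the truncated subtraction on
      naturals agrees with the one in the polynomial, even at \<open>t = 0\<close>.\<close>
    have "poly ([:0, 1:] + of_nat n - 1 - of_nat j) (of_nat t) = (of_nat (t + n - 1 - j) :: rat)"
      if "j \<in> {0..k - 1}" for j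
      using that k_pos k_less by (simp add: of_nat_poly of_nat_diff)
    then show "poly (\<Sum>j = 0..k - 1. of_nat ((k - 1) choose j) * of_nat ((n - k - 1) choose j) *
       poly_choose ([:0, 1:] + of_nat n - 1 - of_nat j) (n - 1)) (of_nat t) =
      of_nat (card (lattice_points ((\<lambda>x. real t *\<^sub>R x) ` matroid_polytope M)))"
      unfolding card_lattice_points poly_sum of_nat_sum atLeast0AtMost[symmetric]
      by (intro sum.cong refl) (simp add: poly_poly_choose of_nat_poly binomial_gbinomial)
  qed
qed

end
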